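(* Let $k\ge 1$ and $r\geq 1$ be integers. The sequence $\{b_{k,n}^{(r)}\}_{n\ge 0}$ (the $r$-times iterated binomial transform of the $k$-Lucas sequence) satisfies, for every integer $n\geq 1$, the recurrence relation $$b_{k,n+1}^{(r)}=(2r+k)\,b_{k,n}^{(r)}-(r^{2}+kr-1)\,b_{k,n-1}^{(r)},$$ with initial conditions $b_{k,0}^{(r)}=2$ and $b_{k,1}^{(r)}=2r+k$.
   Context: The $k$-Lucas sequence $\{L_{k,n}\}_{n\ge 0}$ is defined by $L_{k,0}=2$, $L_{k,1}=k$ and $L_{k,n+1}=kL_{k,n}+L_{k,n-1}$ for $n\ge 1$. The binomial transform of a sequence $\{x_0,x_1,x_2,\ldots\}$ is the sequence $\{b_n\}$ with $b_n=\sum_{i=0}^{n}\binom{n}{i}x_i$. The sequence $\{b_{k,n}^{(r)}\}_{n\ge 0}$ is obtained by applying the binomial transform $r$ times to the $k$-Lucas sequence, i.e. $b_{k,n}^{(0)}=L_{k,n}$ and $b_{k,n}^{(r)}=\sum_{i=0}^{n}\binom{n}{i}b_{k,i}^{(r-1)}$ for $r\ge 1$. *)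

theory Defs
  imports Complex_Main
begin

fun k_lucas :: "int \<Rightarrow> nat \<Rightarrow> int" where
  "k_lucas k 0 = 2"
| "k_lucas k (Suc 0) = k"
| "k_lucas k (Suc (Suc n)) = k * k_lucas k (Suc n) + k_lucas k n"

definition binomial_transform :: "(nat \<Rightarrow> int) \<Rightarrow> nat \<Rightarrow> int" where
  "binomial_transform x n = (\<Sum>i=0..n. int (n choose i) * x i)"

primrec iter_binomial_k_lucas :: "nat \<Rightarrow> int \<Rightarrow> nat \<Rightarrow> int" where
  "iter_binomial_k_lucas 0 k = k_lucas k"
| "iter_binomial_k_lucas (Suc r) k = binomial_transform (iter_binomial_k_lucas r k)"

end

theory Submission
  imports Defs
begin

text \<open>
  Write \<open>T\<close> for the binomial transform and \<open>E\<close> for the shift \<open>(E x) n = x (n + 1)\<close>. Pascal's rule says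
  \<open>E T = T (1 + E)\<close>, that is, \<open>(E - 1) T = T E\<close>: conjugation by \<open>T\<close> turns \<open>E\<close> into \<open>E - 1\<close>. So if
  \<open>x\<close> is annihilated by \<open>E^2 - p E + q\<close>, then \<open>T x\<close> is annihilated by
  \<open>(E - 1)^2 - p (E - 1) + q = E^2 - (p + 2) E + (1 + p + q)\<close>.
  The \<open>k\<close>-Lucas sequence starts with \<open>(p, q) = (k, -1)\<close>, and the map
  \<open>(p, q) \<mapsto> (p + 2, 1 + p + q)\<close> sends \<open>(2 r + k, r^2 + k r - 1)\<close> to the same pair with \<open>r + 1\<close> in
  place of \<open>r\<close>; induction on \<open>r\<close> gives the recurrence. The initial values are equally direct, since
  \<open>(T x) 0 = x 0\<close> and \<open>(T x) 1 = x 0 + x 1\<close>.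
\<close>

lemma binomial_transform_0: "binomial_transform x 0 = x 0"
  by (simp add: binomial_transform_def)

text \<open>
  Pascal's rule, summed against \<open>x\<close>: this is the commutation relation \<open>E T = T + T E\<close>.
\<close>

lemma binomial_transform_Suc:
  "binomial_transform x (Suc n) = binomial_transform x n + binomial_transform (\<lambda>i. x (Suc i)) n"
proof -
  let ?rest = "\<Sum>i=0..n. int (n choose Suc i) * x (Suc i)"
  have "binomial_transform x (Suc n)
      = x 0 + (\<Sum>i=0..n. int (Suc n choose Suc i) * x (Suc i))"
    unfolding binomial_transform_def
    by (subst sum.atLeast0_atMost_Suc_shift) simp
  also have "\<dots> = (x 0 + ?rest) + binomial_transform (\<lambda>i. x (Suc i)) n"
    by (simp add: binomial_transform_def sum.distrib distrib_right)
  also have "x 0 + ?rest = (\<Sum>i=0..Suc n. int (n choose i) * x i)"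
    by (subst sum.atLeast0_atMost_Suc_shift) simp
  \<comment> \<open>The extra top term vanishes because \<open>n choose Suc n = 0\<close>.\<close>
  also have "\<dots> = binomial_transform x n"
    by (simp add: binomial_transform_def)
  finally show ?thesis .
qed

lemma binomial_transform_linear:
  "binomial_transform (\<lambda>i. p * x i - q * y i) n
    = p * binomial_transform x n - q * binomial_transform y n"
  by (simp add: binomial_transform_def sum_subtractf sum_distrib_left algebra_simps)

text \<open>
  The new characteristic polynomial is the old one with the variable shifted by one, so its roots are
  those of the old one increased by 1.
\<close>

lemma binomial_transform_recurrence:
  assumes rec: "\<And>n. x (Suc (Suc n)) = p * x (Suc n) - q * x n"
  shows "binomial_transform x (Suc (Suc n))
    = (p + 2) * binomial_transform x (Suc n) - (1 + p + q) * binomial_transform x n"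
proof -
  let ?T = binomial_transform and ?Ex = "\<lambda>i. x (Suc i)"
  have shift1: "?T x (Suc n) = ?T x n + ?T ?Ex n"
    by (rule binomial_transform_Suc)
  have "?T x (Suc (Suc n)) = ?T x (Suc n) + ?T ?Ex (Suc n)"
    by (rule binomial_transform_Suc)
  moreover have "?T ?Ex (Suc n) = ?T ?Ex n + (p * ?T ?Ex n - q * ?T x n)"
    by (simp add: binomial_transform_Suc[of ?Ex] rec binomial_transform_linear)
  ultimately show ?thesis
    using shift1 by (simp add: algebra_simps)
qed

lemma iter_binomial_k_lucas_recurrence:
  "iter_binomial_k_lucas r k (Suc (Suc n))
    = (2 * int r + k) * iter_binomial_k_lucas r k (Suc n)
      - ((int r)\<^sup>2 + k * int r - 1) * iter_binomial_k_lucas r k n"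
proof (induction r arbitrary: n)
  case 0
  show ?case by simp
next
  case (Suc r)
  have "2 * int (Suc r) + k = (2 * int r + k) + 2"
    and "(int (Suc r))\<^sup>2 + k * int (Suc r) - 1
      = 1 + (2 * int r + k) + ((int r)\<^sup>2 + k * int r - 1)"
    by (simp_all add: power2_eq_square algebra_simps)
  then show ?case
    using binomial_transform_recurrence[where x = "iter_binomial_k_lucas r k", OF Suc.IH]
    by (simp only: iter_binomial_k_lucas.simps)
qed

lemma iter_binomial_k_lucas_0: "iter_binomial_k_lucas r k 0 = 2"
  by (induction r) (simp_all add: binomial_transform_0)

lemma iter_binomial_k_lucas_1: "iter_binomial_k_lucas r k (Suc 0) = 2 * int r + k"
  by (induction r)
    (simp_all add: binomial_transform_Suc binomial_transform_0 iter_binomial_k_lucas_0)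

theorem theorem2p1:
  fixes k :: int and r :: nat
  assumes "k \<ge> 1" and "r \<ge> 1"
  shows "(\<forall>n::nat. n \<ge> 1 \<longrightarrow>
            iter_binomial_k_lucas r k (n + 1) =
              (2 * int r + k) * iter_binomial_k_lucas r k n
              - ((int r)\<^sup>2 + k * int r - 1) * iter_binomial_k_lucas r k (n - 1))
         \<and> iter_binomial_k_lucas r k 0 = 2
         \<and> iter_binomial_k_lucas r k 1 = 2 * int r + k"
proof (intro conjI allI impI)
  fix n :: nat
  assume "n \<ge> 1"
  then obtain m where "n = Suc m"
    by (cases n) auto
  then show "iter_binomial_k_lucas r k (n + 1) =
      (2 * int r + k) * iter_binomial_k_lucas r k n
      - ((int r)\<^sup>2 + k * int r - 1) * iter_binomial_k_lucas r k (n - 1)"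
    using iter_binomial_k_lucas_recurrence[of r k m] by simp
qed (simp_all add: iter_binomial_k_lucas_0 iter_binomial_k_lucas_1)

end
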